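(* Let $0<\alpha<2$, and let $n\ge 0$, $l\ge0$ be integers and $\mu\in\{1,-1\}$. On the open unit disk $\Omega\subset\mathbb{R}^2$ let $$f(x)=(1-r^2)^{\frac{\alpha}{2}}\,V_{l,\mu}(x)\,P_n^{(\frac{\alpha}{2},\,l)}(2r^2-1),\qquad x=(x_1,x_2),\ r=|x|.$$ If $l\ge1$, then on $\Omega$ $$\frac{\partial f}{\partial x_1}=-(n+\tfrac{\alpha}{2})(1-r^2)^{\frac{\alpha}{2}-1}V_{l+1,\mu}(x)P_n^{(\frac{\alpha}{2}-1,\,l+1)}(2r^2-1)-(n+1)(1-r^2)^{\frac{\alpha}{2}-1}V_{l-1,\mu}(x)P_{n+1}^{(\frac{\alpha}{2}-1,\,l-1)}(2r^2-1),$$ $$\frac{\partial f}{\partial x_2}=-\mu\,(n+\tfrac{\alpha}{2})(1-r^2)^{\frac{\alpha}{2}-1}V_{l+1,-\mu}(x)P_n^{(\frac{\alpha}{2}-1,\,l+1)}(2r^2-1)+\mu\,(n+1)(1-r^2)^{\frac{\alpha}{2}-1}V_{l-1,-\mu}(x)P_{n+1}^{(\frac{\alpha}{2}-1,\,l-1)}(2r^2-1).$$ If $l=0$ and $\mu=1$, then on $\Omega$ $$\frac{\partial f}{\partial x_1}=-2(n+\tfrac{\alpha}{2})(1-r^2)^{\frac{\alpha}{2}-1}V_{1,1}(x)P_n^{(\frac{\alpha}{2}-1,\,1)}(2r^2-1),$$ $$\frac{\partial f}{\partial x_2}=-2(n+\tfrac{\alpha}{2})(1-r^2)^{\frac{\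alpha}{2}-1}V_{1,-1}(x)P_n^{(\frac{\alpha}{2}-1,\,1)}(2r^2-1).$$
   Context: $(r,\varphi)$ are polar coordinates of $x=(x_1,x_2)\in\mathbb{R}^2$. $V_{l,1}(x)=r^l\cos(l\varphi)$ for $l\ge0$ and $V_{l,-1}(x)=r^l\sin(l\varphi)$ for $l\ge1$; by convention $V_{0,-1}=0$. $P_n^{(a,b)}$ denotes the Jacobi polynomial in the standard normalization (so $P_0^{(a,b)}=1$ and $P_n^{(a,b)}(1)=\frac{\Gamma(n+a+1)}{n!\,\Gamma(a+1)}$), orthogonal on $(-1,1)$ for the weight $(1-t)^a(1+t)^b$ when $a,b>-1$. *)

theory Defs
  imports "HOL-Analysis.Analysis" "HOL-Computational_Algebra.Polynomial"
begin

text \<open>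
  The Jacobi polynomial in the standard normalization, by its explicit formula in powers of
  \<open>(t - 1) / 2\<close> and \<open>(t + 1) / 2\<close>, which is valid for all real \<open>a\<close>, \<open>b\<close>. The facts
  \<open>jacobiP_at_1\<close>, \<open>jacobiP_poly\<close> and \<open>jacobiP_orthogonal\<close> below show that, for
  \<open>a, b > -1\<close>, this is the polynomial of degree at most \<open>n\<close> that is orthogonal to all
  polynomials of lower degree for the weight \<open>(1 - t)\<^sup>a (1 + t)\<^sup>b\<close> on \<open>(-1, 1)\<close>, normalized by
  its value at \<open>1\<close>.
\<close>

definition jacobiP :: "nat \<Rightarrow> real \<Rightarrow> real \<Rightarrow> real \<Rightarrow> real" where
  "jacobiP n a b t =
     (\<Sum>s\<le>n. ((real n + a) gchoose (n - s)) * ((real n + b) gchoose s) *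
            ((t - 1) / 2) ^ s * ((t + 1) / 2) ^ (n - s))"

lemma jacobiP_0 [simp]: "jacobiP 0 a b t = 1"
  by (simp add: jacobiP_def)

lemma jacobiP_at_1:
  assumes "a > -1"
  shows "jacobiP n a b 1 = Gamma (real n + a + 1) / (fact n * Gamma (a + 1))"
proof -
  have "jacobiP n a b 1 =
      (\<Sum>s\<le>n. if s = 0 then (real n + a) gchoose n else 0)"
    unfolding jacobiP_def by (intro sum.cong) auto
  also have "\<dots> = (real n + a) gchoose n"
    by simp
  also have "\<dots> = Gamma (real n + a + 1) / (fact n * Gamma (a + 1))"
    using assms by (subst gbinomial_Gamma) (auto elim!: nonpos_Ints_cases)
  finally show ?thesis .
qed

lemma jacobiP_poly: "\<exists>p. degree p \<le> n \<and> (\<forall>t. jacobiP n a b t = poly p t)"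
proof -
  define p where "p = (\<Sum>s\<le>n. smult (((real n + a) gchoose (n - s)) * ((real n + b) gchoose s))
     ([:-1/2, 1/2:] ^ s * [:1/2, 1/2:] ^ (n - s)))"
  have "degree p \<le> n"
    unfolding p_def
  proof (intro degree_sum_le order_trans[OF degree_smult_le])
    fix s assume "s \<in> {..n}"
    have "degree ([:-1/2, 1/2:] ^ s * [:1/2, 1/2:] ^ (n - s) :: real poly)
        \<le> degree ([:-1/2, 1/2:] ^ s :: real poly) + degree ([:1/2, 1/2:] ^ (n - s) :: real poly)"
      by (rule degree_mult_le)
    also have "\<dots> \<le> s + (n - s)"
      by (intro add_mono order_trans[OF degree_power_le]) auto
    finally show "degree ([:-1/2, 1/2:] ^ s * [:1/2, 1/2:] ^ (n - s) :: real poly) \<le> n"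
      using \<open>s \<in> {..n}\<close> by simp
  qed auto
  moreover have "jacobiP n a b t = poly p t" for t
    unfolding p_def jacobiP_def poly_sum
    by (intro sum.cong) (auto simp: poly_power diff_divide_distrib add_divide_distrib add.commute)
  ultimately show ?thesis by blast
qed

lemma alternating_binomial_Suc:
  fixes g :: "nat \<Rightarrow> real"
  shows "(\<Sum>s\<le>Suc n. (-1) ^ s * real (Suc n choose s) * g s) =
         (\<Sum>s\<le>n. (-1) ^ s * real (n choose s) * (g s - g (Suc s)))"
proof -
  have "(\<Sum>s\<le>Suc n. (-1) ^ s * real (Suc n choose s) * g s) =
      g 0 + (\<Sum>s\<le>n. (-1) ^ Suc s * real (n choose Suc s) * g (Suc s))
          + (\<Sum>s\<le>n. (-1) ^ Suc s * real (n choose s) * g (Suc s))"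
    by (subst sum.atMost_Suc_shift) (simp add: algebra_simps sum.distrib sum_negf sum_subtractf)
  also have "g 0 + (\<Sum>s\<le>n. (-1) ^ Suc s * real (n choose Suc s) * g (Suc s)) =
      (\<Sum>s\<le>Suc n. (-1) ^ s * real (n choose s) * g s)"
    by (subst sum.atMost_Suc_shift) simp
  also have "\<dots> = (\<Sum>s\<le>n. (-1) ^ s * real (n choose s) * g s)"
    by simp
  finally show ?thesis
    by (simp add: algebra_simps sum.distrib sum_negf sum_subtractf)
qed

lemma alternating_binomial_pochhammer:
  assumes "k < n"
  shows "(\<Sum>s\<le>n. (-1) ^ s * real (n choose s) * pochhammer (c + real s) k) = 0"
  using assms
proof (induction n arbitrary: k c)
  case (Suc n)
  show ?case
  proof (cases k)
    case 0
    show ?thesis unfolding alternating_binomial_Suc 0 by simp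
  next
    case (Suc j)
    have diff: "pochhammer (c + real s) k - pochhammer (c + real (Suc s)) k =
        - real k * pochhammer ((c + 1) + real s) j" for s
    proof -
      have "pochhammer (c + real s) k = (c + real s) * pochhammer (c + real s + 1) j"
        by (simp add: Suc pochhammer_rec)
      moreover have "pochhammer (c + real (Suc s)) k =
          pochhammer (c + real s + 1) j * (c + real s + 1 + real j)"
        by (simp add: Suc pochhammer_rec' algebra_simps)
      ultimately show ?thesis by (simp add: Suc algebra_simps)
    qed
    have "(\<Sum>s\<le>n. (-1) ^ s * real (n choose s) *
            (pochhammer (c + real s) k - pochhammer (c + real (Suc s)) k)) =
          - real k * (\<Sum>s\<le>n. (-1) ^ s * real (n choose s) * pochhammer ((c + 1) + real s) j)"
      unfolding diff sum_distrib_left by (intro sum.cong) auto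
    also have "\<dots> = 0"
      using Suc.IH[of j "c + 1"] Suc.prems Suc by simp
    finally show ?thesis
      unfolding alternating_binomial_Suc .
  qed
qed simp

lemma jacobiP_orthogonal_unit:
  assumes ab: "a > -1" "b > -1" and k: "k < n"
  shows "((\<lambda>u. (1 - u) powr a * u powr b * jacobiP n a b (2 * u - 1) * u ^ k) has_integral 0) {0..1}"
proof -
  define c where "c s = ((real n + a) gchoose (n - s)) * ((real n + b) gchoose s)" for s
  define B where "B s = Beta (b + real (n - s) + real k + 1) (a + real s + 1)" for s
  have "((\<lambda>u. \<Sum>s\<le>n. c s * (-1) ^ s *
           (u powr ((b + real (n - s) + real k + 1) - 1) * (1 - u) powr ((a + real s + 1) - 1)))
         has_integral (\<Sum>s\<le>n. c s * (-1) ^ s * B s)) {0..1}"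
    unfolding B_def using ab
    by (intro has_integral_sum has_integral_mult_right has_integral_Beta_real) auto
  also have "(\<Sum>s\<le>n. c s * (-1) ^ s * B s) = 0"
  proof -
    define K where "K = Gamma (real n + a + 1) * Gamma (real n + b + 1) /
      (fact n * Gamma (real n + a + b + real k + 2))"
    have term_eq: "c s * (-1) ^ s * B s =
        K * (-1) ^ n * ((-1) ^ (n - s) * real (n choose (n - s)) * pochhammer (b + 1 + real (n - s)) k)"
      if s: "s \<le> n" for s
    proof -
      have pos: "Gamma (a + real s + 1) > 0" "Gamma (b + real (n - s) + 1) > 0"
        using ab by (auto intro!: Gamma_real_pos)
      have 1: "(real n + a) gchoose (n - s) =
          Gamma (real n + a + 1) / (fact (n - s) * Gamma (a + real s + 1))"
        using ab s by (subst gbinomial_Gamma) (auto elim!: nonpos_Ints_cases simp: of_nat_diff add_ac)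
      have 2: "(real n + b) gchoose s =
          Gamma (real n + b + 1) / (fact s * Gamma (b + real (n - s) + 1))"
        using ab s by (subst gbinomial_Gamma)
          (auto elim!: nonpos_Ints_cases simp: of_nat_diff algebra_simps)
      have 3: "pochhammer (b + 1 + real (n - s)) k =
          Gamma (b + real (n - s) + real k + 1) / Gamma (b + real (n - s) + 1)"
        using ab by (subst pochhammer_Gamma) (auto elim!: nonpos_Ints_cases simp: add_ac)
      have 4: "real (n choose (n - s)) = fact n / (fact s * fact (n - s))"
        using s by (simp add: binomial_fact)
      have 5: "B s = Gamma (b + real (n - s) + real k + 1) * Gamma (a + real s + 1) /
          Gamma (real n + a + b + real k + 2)"
        using s by (simp add: B_def Beta_def of_nat_diff algebra_simps)
      have 6: "(-1) ^ n * (-1) ^ (n - s) = ((-1) ^ s :: real)"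
      proof -
        have "(-1) ^ n = ((-1) ^ s * (-1) ^ (n - s) :: real)"
          using s by (simp flip: power_add)
        thus ?thesis by simp
      qed
      have "K * (-1) ^ n * ((-1) ^ (n - s) * real (n choose (n - s)) * pochhammer (b + 1 + real (n - s)) k)
          = K * (-1) ^ s * (real (n choose (n - s)) * pochhammer (b + 1 + real (n - s)) k)"
        unfolding 6[symmetric] by (simp add: mult_ac)
      also have "\<dots> = c s * (-1) ^ s * B s"
        unfolding c_def 1 2 3 4 5 K_def using pos by simp
      finally show ?thesis ..
    qed
    have "(\<Sum>s\<le>n. c s * (-1) ^ s * B s) = K * (-1) ^ n *
      (\<Sum>s\<le>n. (-1) ^ (n - s) * real (n choose (n - s)) * pochhammer (b + 1 + real (n - s)) k)"
      unfolding sum_distrib_left by (intro sum.cong term_eq refl) auto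
    also have "(\<Sum>s\<le>n. (-1) ^ (n - s) * real (n choose (n - s)) * pochhammer (b + 1 + real (n - s)) k)
      = (\<Sum>s\<le>n. (-1) ^ s * real (n choose s) * pochhammer (b + 1 + real s) k)"
      by (rule sum.reindex_bij_witness[of _ "\<lambda>s. n - s" "\<lambda>s. n - s"]) auto
    also have "\<dots> = 0"
      by (rule alternating_binomial_pochhammer[OF k])
    finally show ?thesis by simp
  qed
  finally have *: "((\<lambda>u. \<Sum>s\<le>n. c s * (-1) ^ s *
       (u powr ((b + real (n - s) + real k + 1) - 1) * (1 - u) powr ((a + real s + 1) - 1)))
     has_integral 0) {0<..<1}"
    by (simp add: has_integral_Icc_iff_Ioo)
  have "((\<lambda>u. (1 - u) powr a * u powr b * jacobiP n a b (2 * u - 1) * u ^ k) has_integral 0) {0<..<1}"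
  proof (rule has_integral_eq[OF _ *])
    fix u :: real assume u: "u \<in> {0<..<1}"
    have eq: "c s * (-1) ^ s *
          (u powr ((b + real (n - s) + real k + 1) - 1) * (1 - u) powr ((a + real s + 1) - 1)) =
        (1 - u) powr a * u powr b * (c s * (u - 1) ^ s * u ^ (n - s)) * u ^ k" for s
    proof -
      have "(u - 1) ^ s = (-1) ^ s * (1 - u) ^ s"
        by (simp flip: power_mult_distrib)
      thus ?thesis using u by (simp add: powr_add powr_realpow mult_ac)
    qed
    have "jacobiP n a b (2 * u - 1) = (\<Sum>s\<le>n. c s * (u - 1) ^ s * u ^ (n - s))"
      unfolding jacobiP_def c_def by (intro sum.cong) (auto simp: diff_divide_distrib)
    thus "(\<Sum>s\<le>n. c s * (-1) ^ s *
         (u powr ((b + real (n - s) + real k + 1) - 1) * (1 - u) powr ((a + real s + 1) - 1))) =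
       (1 - u) powr a * u powr b * jacobiP n a b (2 * u - 1) * u ^ k"
      unfolding eq by (simp add: sum_distrib_left sum_distrib_right)
  qed
  thus ?thesis by (simp add: has_integral_Icc_iff_Ioo)
qed

lemma jacobiP_orthogonal:
  assumes ab: "a > -1" "b > -1" and q: "degree q < n"
  shows "((\<lambda>t. (1 - t) powr a * (1 + t) powr b * jacobiP n a b t * poly q t) has_integral 0) {-1<..<1}"
proof -
  define h where "h = q \<circ>\<^sub>p [:-1, 2:]"
  have deg: "degree h < n"
    using q by (simp add: h_def degree_pcompose)
  define F where "F u = (1 - u) powr a * u powr b * jacobiP n a b (2 * u - 1) * poly h u" for u
  have "((\<lambda>u. \<Sum>k\<le>degree h. coeff h k *
          ((1 - u) powr a * u powr b * jacobiP n a b (2 * u - 1) * u ^ k)) has_integral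
         (\<Sum>k\<le>degree h. coeff h k * 0)) {0..1}"
    using deg ab by (intro has_integral_sum has_integral_mult_right jacobiP_orthogonal_unit) auto
  also have "(\<lambda>u. \<Sum>k\<le>degree h. coeff h k *
          ((1 - u) powr a * u powr b * jacobiP n a b (2 * u - 1) * u ^ k)) = F"
    by (simp add: F_def fun_eq_iff poly_altdef sum_distrib_left mult_ac)
  finally have "(F has_integral 0) (cbox 0 1)" by simp
  from has_integral_affinity'[OF this, of "1/2" "1/2"]
  have "((\<lambda>t. F ((1/2) * t + 1/2)) has_integral 0) {-1..1}"
    by simp
  hence "((\<lambda>t. 2 powr (a + b) * F ((1/2) * t + 1/2)) has_integral 2 powr (a + b) * 0) {-1<..<1}"
    by (intro has_integral_mult_right) (simp add: has_integral_Icc_iff_Ioo)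
  hence *: "((\<lambda>t. 2 powr (a + b) * F ((1/2) * t + 1/2)) has_integral 0) {-1<..<1}"
    by simp
  show ?thesis
  proof (rule has_integral_eq[OF _ *])
    fix t :: real assume t: "t \<in> {-1<..<1}"
    have 1: "2 powr a * (1 - ((1/2) * t + 1/2)) powr a = (1 - t) powr a"
      using t by (subst powr_mult[symmetric]) (auto simp: algebra_simps)
    have 2: "2 powr b * ((1/2) * t + 1/2) powr b = (1 + t) powr b"
      using t by (subst powr_mult[symmetric]) (auto simp: algebra_simps)
    have 3: "poly h ((1/2) * t + 1/2) = poly q t" "2 * ((1/2) * t + 1/2) - 1 = t"
      by (simp_all add: h_def poly_pcompose algebra_simps)
    have "2 powr (a + b) * F ((1/2) * t + 1/2) =
        (2 powr a * (1 - ((1/2) * t + 1/2)) powr a) * (2 powr b * ((1/2) * t + 1/2) powr b) *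
        jacobiP n a b t * poly q t"
      unfolding F_def 3 powr_add by (simp only: mult_ac)
    thus "2 powr (a + b) * F ((1/2) * t + 1/2) =
        (1 - t) powr a * (1 + t) powr b * jacobiP n a b t * poly q t"
      unfolding 1 2 .
  qed
qed

definition polar_angle :: "real ^ 2 \<Rightarrow> real" where
  "polar_angle x = Arg (Complex (x $ 1) (x $ 2))"

text \<open>
  \<open>solidV l \<mu>\<close> is only meant for \<open>\<mu> \<in> {1, -1}\<close>. The convention \<open>solidV 0 (-1) = 0\<close> is
  automatic because \<open>sin 0 = 0\<close>. The choice of the polar angle, at the
  origin too, does not matter (\<open>solidV_polar\<close>);
  \<open>solidV 0 1 = 1\<close> there because \<open>0 ^ 0 = 1\<close>.
\<close>

definition solidV :: "nat \<Rightarrow> int \<Rightarrow> real ^ 2 \<Rightarrow> real" where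
  "solidV l \<mu> x =
     (if \<mu> = 1 then norm x ^ l * cos (real l * polar_angle x)
      else norm x ^ l * sin (real l * polar_angle x))"

lemma solidV_0_minus [simp]: "solidV 0 (-1) x = 0"
  by (simp add: solidV_def)

lemma solidV_0_plus [simp]: "solidV 0 1 x = 1"
  by (simp add: solidV_def)

lemma norm_polar: "norm (x :: real ^ 2) = cmod (Complex (x $ 1) (x $ 2))"
  by (simp add: norm_vec_def L2_set_def sum_2 cmod_def)

lemma solidV_Complex:
  "Complex (solidV l 1 x) (solidV l (-1) x) = Complex (x $ 1) (x $ 2) ^ l"
proof -
  have "Complex (x $ 1) (x $ 2) ^ l = rcis (norm x) (polar_angle x) ^ l"
    by (simp add: norm_polar polar_angle_def rcis_cmod_Arg)
  also have "\<dots> = rcis (norm x ^ l) (real l * polar_angle x)"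
    by (rule DeMoivre2)
  finally show ?thesis
    by (simp add: complex_eq_iff solidV_def)
qed

lemma solidV_polar:
  assumes "x $ 1 = r * cos p" "x $ 2 = r * sin p"
  shows "solidV l 1 x = r ^ l * cos (real l * p)" "solidV l (-1) x = r ^ l * sin (real l * p)"
proof -
  have "Complex (x $ 1) (x $ 2) = rcis r p"
    using assms by (simp add: complex_eq_iff)
  hence "Complex (solidV l 1 x) (solidV l (-1) x) = rcis (r ^ l) (real l * p)"
    by (simp add: solidV_Complex DeMoivre2)
  thus "solidV l 1 x = r ^ l * cos (real l * p)" "solidV l (-1) x = r ^ l * sin (real l * p)"
    by (simp_all add: complex_eq_iff)
qed

definition has_partial_derivative ::
    "(real ^ 'n \<Rightarrow> real) \<Rightarrow> 'n \<Rightarrow> real \<Rightarrow> real ^ 'n \<Rightarrow> bool" where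
  "has_partial_derivative f i D x \<longleftrightarrow>
     ((\<lambda>h. f (x + h *\<^sub>R axis i 1)) has_real_derivative D) (at 0)"

end

theory Submission
  imports Defs
begin

text \<open>
  Identify \<open>x\<close> with \<open>z = x\<^sub>1 + i x\<^sub>2\<close>, so that \<open>f\<close> is the real or imaginary part of
  \<open>z\<^sup>l g(z conj(z))\<close> with \<open>g(u) = (1 - u)\<^sup>a P\<^sub>n(2u - 1)\<close> and \<open>a = \<alpha>/2\<close>. For a direction
  \<open>d \<in> {1, i}\<close> one has \<open>2 (z \<bullet> d) = d conj(z) + conj(d) z\<close>, hence the directional derivative is
  \<open>d (l g + u g') z\<^bsup>l-1\<^esup> + conj(d) g' z\<^bsup>l+1\<^esup>\<close>. The two radial factors are
  \<open>g' = -(n+a) (1-u)\<^bsup>a-1\<^esup> P\<^sub>n\<close> with parameters \<open>(a-1, l+1)\<close>, and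
  \<open>l g + u g' = -(n+1) (1-u)\<^bsup>a-1\<^esup> P\<^bsub>n+1\<^esub>\<close> with parameters \<open>(a-1, l-1)\<close>; both follow by
  comparing coefficients of the explicit sums in powers of \<open>u - 1\<close> and \<open>u\<close>.
\<close>

section \<open>Differentiating Jacobi polynomials in the variable \<open>u\<close>\<close>

text \<open>Termwise derivative in \<open>u\<close> of \<open>jacobiP n a b (2 * u - 1)\<close>, not
  in the argument of the polynomial. The truncated exponents \<open>s - 1\<close> and
  \<open>n - s - 1\<close> do no harm: the factor in front is zero whenever truncation
  occurs.\<close>

definition jacobiP_deriv :: "nat \<Rightarrow> real \<Rightarrow> real \<Rightarrow> real \<Rightarrow> real" where
  "jacobiP_deriv n a b u =
     (\<Sum>s\<le>n. ((real n + a) gchoose (n - s)) * ((real n + b) gchoose s) *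
            (real s * (u - 1) ^ (s - 1) * u ^ (n - s)
             + real (n - s) * (u - 1) ^ s * u ^ (n - s - 1)))"

lemma jacobiP_shifted:
  "jacobiP n a b (2 * u - 1) =
     (\<Sum>s\<le>n. ((real n + a) gchoose (n - s)) * ((real n + b) gchoose s) * (u - 1) ^ s * u ^ (n - s))"
  unfolding jacobiP_def by (intro sum.cong) (auto simp: diff_divide_distrib)

lemma jacobiP_shifted_deriv:
  "((\<lambda>u. jacobiP n a b (2 * u - 1)) has_real_derivative jacobiP_deriv n a b u) (at u)"
  unfolding jacobiP_shifted jacobiP_deriv_def
  by (auto intro!: derivative_eq_intros sum.cong simp: algebra_simps)

text \<open>Times \<open>(1 - u) powr (a - 1)\<close>, the left side is the derivative of
  \<open>(1 - u) powr a * jacobiP n a b (2 * u - 1)\<close>. The expanded form is the common source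
  of both relations below. The second sum omits \<open>s = n\<close>, where \<open>n - s\<close>
  vanishes, so \<open>n - Suc s\<close> is a true difference.\<close>

lemma weighted_jacobiP_deriv_sum:
  fixes u :: real
  shows "(1 - u) * jacobiP_deriv n a b u - a * jacobiP n a b (2 * u - 1) =
    - (\<Sum>s\<le>n. ((real n + a) gchoose (n - s)) * ((real n + b) gchoose s) *
           ((a + real s) * (u - 1) ^ s * u ^ (n - s)))
    - (\<Sum>s<n. ((real n + a) gchoose (n - s)) * ((real n + b) gchoose s) *
           (real (n - s) * (u - 1) ^ Suc s * u ^ (n - Suc s)))"
proof -
  \<comment> \<open>At \<open>s = 0\<close> the exponent truncates, but both sides are 0.\<close>
  have pw: "(1 - u) * (real s * (u - 1) ^ (s - 1)) = - real s * (u - 1) ^ s" for s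
    by (cases s) (auto simp: algebra_simps)
  have "(1 - u) * jacobiP_deriv n a b u - a * jacobiP n a b (2 * u - 1) =
    (\<Sum>s\<le>n. - (((real n + a) gchoose (n - s)) * ((real n + b) gchoose s) *
           ((a + real s) * (u - 1) ^ s * u ^ (n - s)))
     - ((real n + a) gchoose (n - s)) * ((real n + b) gchoose s) *
           (real (n - s) * (u - 1) ^ Suc s * u ^ (n - Suc s)))"
    unfolding jacobiP_deriv_def jacobiP_shifted sum_distrib_left sum_subtractf[symmetric]
  proof (intro sum.cong refl)
    fix s
    let ?c = "((real n + a) gchoose (n - s)) * ((real n + b) gchoose s)"
    have "(1 - u) * (?c * (real s * (u - 1) ^ (s - 1) * u ^ (n - s)
             + real (n - s) * (u - 1) ^ s * u ^ (n - s - 1))) =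
        ?c * ((1 - u) * (real s * (u - 1) ^ (s - 1))) * u ^ (n - s)
        + ?c * ((1 - u) * (real (n - s) * (u - 1) ^ s * u ^ (n - s - 1)))"
      by (simp only: algebra_simps)
    thus "(1 - u) * (?c * (real s * (u - 1) ^ (s - 1) * u ^ (n - s)
             + real (n - s) * (u - 1) ^ s * u ^ (n - s - 1))) - a * (?c * (u - 1) ^ s * u ^ (n - s)) =
        - (?c * ((a + real s) * (u - 1) ^ s * u ^ (n - s)))
        - ?c * (real (n - s) * (u - 1) ^ Suc s * u ^ (n - Suc s))"
      unfolding pw by (simp add: algebra_simps)
  qed
  thus ?thesis
    by (simp add: sum_subtractf sum_negf lessThan_Suc_atMost[symmetric])
qed

section \<open>Absorption identities for the coefficients\<close>

text \<open>Applied summand by summand: \<open>A\<close> and \<open>B\<close> are the two binomial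
  coefficients, \<open>P\<close> and \<open>Q\<close> the powers of \<open>u - 1\<close> and
  \<open>u\<close>, and the linear factor \<open>x\<close> is absorbed into
  \<open>A\<close>.\<close>

lemma mult_exchange_left:
  fixes x A r A' B P Q :: real
  assumes "x * A = r * A'"
  shows "A * B * (x * P * Q) = r * (A' * B * P * Q)"
  using assms by algebra

lemma mult_exchange_right:
  fixes x A r B B' P Q :: real
  assumes "r * B' = x * B"
  shows "A * B * (x * P * Q) = r * (A * B' * P * Q)"
  using assms by algebra

lemma gchoose_lower:
  fixes a :: real
  assumes "s \<le> n"
  shows "(a + real s) * ((real n + a) gchoose (n - s)) =
    (real n + a) * ((real n + (a - 1)) gchoose (n - s))"
  using gbinomial_absorb_comp[of "real n + a" "n - s"] assms
  by (simp add: of_nat_diff algebra_simps)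

lemma gchoose_absorb:
  fixes a :: real
  assumes "s < n"
  shows "real (n - s) * ((real n + a) gchoose (n - s)) =
    (real n + a) * ((real n + (a - 1)) gchoose (n - Suc s))"
  using gbinomial_absorption[of "n - Suc s" "real n + a"] assms
  by (simp add: Suc_diff_Suc algebra_simps)

text \<open>Both sides equal
  \<open>(real n + a) * ((real n + (a - 1)) gchoose (n - s))\<close>.\<close>

lemma gchoose_exchange:
  fixes a :: real
  assumes "s \<le> n"
  shows "(a + real s) * ((real n + a) gchoose (n - s)) =
    real (Suc n - s) * ((real n + a) gchoose (Suc n - s))"
  using gchoose_lower[OF assms] gbinomial_absorption[of "n - s" "real n + a"] assms
  by (simp add: Suc_diff_le algebra_simps)

section \<open>The two relations between neighbouring Jacobi polynomials\<close>

text \<open>Pascal's rule for the binomial containing \<open>b + 1\<close> splits the right side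
  into two sums. They match those of \<open>weighted_jacobiP_deriv_sum\<close> once absorption has
  pulled out \<open>real n + a\<close>.\<close>

lemma jacobiP_lower_raise:
  "(1 - u) * jacobiP_deriv n a b u - a * jacobiP n a b (2 * u - 1) =
    - (real n + a) * jacobiP n (a - 1) (b + 1) (2 * u - 1)"
proof -
  let ?A = "\<lambda>s. (real n + (a - 1)) gchoose (n - s)" and ?B = "\<lambda>s. (real n + b) gchoose s"
  have "jacobiP n (a - 1) (b + 1) (2 * u - 1) =
      (\<Sum>s\<le>n. ?A s * ?B s * (u - 1) ^ s * u ^ (n - s)) +
      (\<Sum>s<n. ?A (Suc s) * ?B s * (u - 1) ^ Suc s * u ^ (n - Suc s))"
  proof (cases n)
    case (Suc m)
    have pascal: "(real n + (b + 1)) gchoose Suc s = ?B s + ?B (Suc s)" for s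
      using gbinomial_addition_formula[of "real n + b + 1" s] by (simp add: algebra_simps)
    show ?thesis
      unfolding jacobiP_shifted Suc lessThan_Suc_atMost
      by (subst (1 2) sum.atMost_Suc_shift)
        (use pascal in \<open>simp add: Suc algebra_simps sum.distrib sum_subtractf\<close>)
  qed simp
  moreover have "(\<Sum>s\<le>n. ((real n + a) gchoose (n - s)) * ?B s *
           ((a + real s) * (u - 1) ^ s * u ^ (n - s))) =
     (real n + a) * (\<Sum>s\<le>n. ?A s * ?B s * (u - 1) ^ s * u ^ (n - s))"
    unfolding sum_distrib_left using gchoose_lower[of _ n a]
    by (intro sum.cong refl mult_exchange_left) simp
  moreover have "(\<Sum>s<n. ((real n + a) gchoose (n - s)) * ?B s *
           (real (n - s) * (u - 1) ^ Suc s * u ^ (n - Suc s))) =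
     (real n + a) * (\<Sum>s<n. ?A (Suc s) * ?B s * (u - 1) ^ Suc s * u ^ (n - Suc s))"
    unfolding sum_distrib_left using gchoose_absorb[of _ n a]
    by (intro sum.cong refl mult_exchange_left) simp
  ultimately show ?thesis
    unfolding weighted_jacobiP_deriv_sum by (simp add: algebra_simps)
qed

text \<open>Raising \<open>n\<close> while lowering \<open>a\<close> and \<open>b\<close> by 1 keeps
  the upper binomial entries \<open>n + a\<close> and \<open>n + b\<close>. Writing
  \<open>n + 1\<close> as \<open>(Suc n - s) + s\<close>, the first part is absorbed into the
  binomial with \<open>a\<close>, the second into the one with \<open>b\<close>.\<close>

lemma jacobiP_raise_lower:
  "b * ((1 - u) * jacobiP n a b (2 * u - 1)) +
   u * ((1 - u) * jacobiP_deriv n a b u - a * jacobiP n a b (2 * u - 1)) =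
    - (real n + 1) * jacobiP (Suc n) (a - 1) (b - 1) (2 * u - 1)"
proof -
  let ?A = "\<lambda>s. (real n + a) gchoose (n - s)" and ?B = "\<lambda>s. (real n + b) gchoose s"
  let ?T = "\<lambda>s. ((real n + a) gchoose (Suc n - s)) * ?B s * (u - 1) ^ s * u ^ (Suc n - s)"
  have "(real n + 1) * jacobiP (Suc n) (a - 1) (b - 1) (2 * u - 1) =
      (\<Sum>s\<le>Suc n. real (Suc n - s) * ?T s) + (\<Sum>s\<le>Suc n. real s * ?T s)"
    unfolding jacobiP_shifted sum_distrib_left sum.distrib[symmetric]
    by (intro sum.cong refl) (auto simp: of_nat_diff algebra_simps)
  also have "(\<Sum>s\<le>Suc n. real (Suc n - s) * ?T s) =
      (\<Sum>s\<le>n. ?A s * ?B s * ((a + real s) * (u - 1) ^ s * u ^ (Suc n - s)))"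
  proof -
    have "(\<Sum>s\<le>Suc n. real (Suc n - s) * ?T s) = (\<Sum>s\<le>n. real (Suc n - s) * ?T s)"
      by simp
    also have "\<dots> = (\<Sum>s\<le>n. ?A s * ?B s * ((a + real s) * (u - 1) ^ s * u ^ (Suc n - s)))"
      by (intro sum.cong refl mult_exchange_left[symmetric] gchoose_exchange) simp
    finally show ?thesis .
  qed
  also have "(\<Sum>s\<le>Suc n. real s * ?T s) =
      (\<Sum>s\<le>n. ?A s * ?B s * ((b + real (n - s)) * (u - 1) ^ Suc s * u ^ (n - s)))"
  proof -
    \<comment> \<open>Both sides equal
      \<open>(real n + b) * ((real n + b - 1) gchoose s)\<close>.\<close>
    have step: "real (Suc s) * ?B (Suc s) = (b + real (n - s)) * ?B s" if "s \<le> n" for s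
      using gbinomial_absorption[of s "real n + b"] gbinomial_absorb_comp[of "real n + b" s] that
      by (simp add: of_nat_diff algebra_simps)
    have "(\<Sum>s\<le>Suc n. real s * ?T s) = (\<Sum>s\<le>n. real (Suc s) * ?T (Suc s))"
      by (subst sum.atMost_Suc_shift) simp
    also have "\<dots> = (\<Sum>s\<le>n. ?A s * ?B s * ((b + real (n - s)) * (u - 1) ^ Suc s * u ^ (n - s)))"
      unfolding diff_Suc_Suc by (intro sum.cong refl mult_exchange_right[symmetric] step) simp
    finally show ?thesis .
  qed
  also have "(\<Sum>s\<le>n. ?A s * ?B s * ((b + real (n - s)) * (u - 1) ^ Suc s * u ^ (n - s))) =
      b * ((u - 1) * jacobiP n a b (2 * u - 1)) +
      (\<Sum>s\<le>n. ?A s * ?B s * (real (n - s) * (u - 1) ^ Suc s * u ^ (n - s)))"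
    unfolding jacobiP_shifted sum_distrib_left sum.distrib[symmetric]
    by (intro sum.cong refl) (simp add: algebra_simps)
  \<comment> \<open>A factor \<open>u\<close> comes out because the summand \<open>s = n\<close>,
    the only one without it, is zero.\<close>
  also have "(\<Sum>s\<le>n. ?A s * ?B s * (real (n - s) * (u - 1) ^ Suc s * u ^ (n - s))) =
      u * (\<Sum>s<n. ?A s * ?B s * (real (n - s) * (u - 1) ^ Suc s * u ^ (n - Suc s)))"
  proof -
    have "u ^ (n - s) = u * u ^ (n - Suc s)" if "s < n" for s
      using that by (simp flip: power_Suc add: Suc_diff_Suc)
    thus ?thesis
      unfolding lessThan_Suc_atMost[symmetric] sum_distrib_left by (simp add: mult_ac)
  qed
  also have "(\<Sum>s\<le>n. ?A s * ?B s * ((a + real s) * (u - 1) ^ s * u ^ (Suc n - s))) =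
      u * (\<Sum>s\<le>n. ?A s * ?B s * ((a + real s) * (u - 1) ^ s * u ^ (n - s)))"
    unfolding sum_distrib_left
    by (intro sum.cong refl) (simp add: Suc_diff_le mult_ac)
  finally show ?thesis
    unfolding weighted_jacobiP_deriv_sum by (simp add: algebra_simps)
qed

section \<open>The two radial factors\<close>

text \<open>The product rule gives \<open>(1 - u) powr (a - 1)\<close> times the left side of
  \<open>jacobiP_lower_raise\<close>.\<close>

lemma weighted_jacobiP_deriv:
  assumes "u < 1"
  shows "((\<lambda>u. (1 - u) powr a * jacobiP n a b (2 * u - 1)) has_real_derivative
           - (real n + a) * ((1 - u) powr (a - 1) * jacobiP n (a - 1) (b + 1) (2 * u - 1))) (at u)"
proof -
  have split: "(1 - u) powr a = (1 - u) powr (a - 1) * (1 - u)"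
    using assms by (simp add: powr_diff)
  have "((\<lambda>u. (1 - u) powr a * jacobiP n a b (2 * u - 1)) has_real_derivative
      (- a * (1 - u) powr (a - 1)) * jacobiP n a b (2 * u - 1)
      + (1 - u) powr a * jacobiP_deriv n a b u) (at u)"
    using assms by (auto intro!: derivative_eq_intros jacobiP_shifted_deriv)
  also have "(- a * (1 - u) powr (a - 1)) * jacobiP n a b (2 * u - 1)
      + (1 - u) powr a * jacobiP_deriv n a b u =
      (1 - u) powr (a - 1) * ((1 - u) * jacobiP_deriv n a b u - a * jacobiP n a b (2 * u - 1))"
    unfolding split by (simp add: algebra_simps)
  finally show ?thesis
    unfolding jacobiP_lower_raise by (simp add: mult_ac)
qed

text \<open>With g the function differentiated in \<open>weighted_jacobiP_deriv\<close>, the left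
  side is b g + u g'; for b = l this is the coefficient of the power of z with exponent l -
  1.\<close>

lemma weighted_jacobiP_euler:
  assumes "u < 1"
  shows "b * ((1 - u) powr a * jacobiP n a b (2 * u - 1)) +
         u * (- (real n + a) * ((1 - u) powr (a - 1) * jacobiP n (a - 1) (b + 1) (2 * u - 1))) =
         - (real n + 1) * ((1 - u) powr (a - 1) * jacobiP (n + 1) (a - 1) (b - 1) (2 * u - 1))"
proof -
  have split: "(1 - u) powr a = (1 - u) powr (a - 1) * (1 - u)"
    using assms by (simp add: powr_diff)
  have "b * ((1 - u) powr a * jacobiP n a b (2 * u - 1)) +
        u * (- (real n + a) * ((1 - u) powr (a - 1) * jacobiP n (a - 1) (b + 1) (2 * u - 1))) =
        (1 - u) powr (a - 1) * (b * ((1 - u) * jacobiP n a b (2 * u - 1)) +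
          u * (- (real n + a) * jacobiP n (a - 1) (b + 1) (2 * u - 1)))"
    unfolding split by (simp add: algebra_simps)
  also have "\<dots> = (1 - u) powr (a - 1) * (- (real n + 1) * jacobiP (Suc n) (a - 1) (b - 1) (2 * u - 1))"
    unfolding jacobiP_lower_raise[symmetric] jacobiP_raise_lower ..
  finally show ?thesis by (simp add: mult_ac)
qed

section \<open>Partial derivatives of a radial function times a solid harmonic\<close>

text \<open>Both harmonics are handled at once as components of \<open>z ^ l\<close>: moving
  \<open>x\<close> along axis \<open>i\<close> replaces \<open>z\<close> by
  \<open>z + of_real h * d\<close>, and the product rule yields \<open>D\<close>. For
  \<open>l = 0\<close> the truncated exponent is cancelled by the factor
  \<open>of_nat l\<close>.\<close>

lemma solidV_radial_deriv:
  fixes x :: "real ^ 2" and g :: "real \<Rightarrow> real" and g' :: real and i :: 2 and l :: nat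
  defines "z \<equiv> Complex (x $ 1) (x $ 2)"
  defines "d \<equiv> (if i = 1 then 1 else \<i>)"
  defines "D \<equiv> of_nat l * z ^ (l - 1) * d * of_real (g ((norm x)\<^sup>2)) + z ^ l * of_real (g' * (2 * x $ i))"
  assumes g: "(g has_real_derivative g') (at ((norm x)\<^sup>2))"
  shows "has_partial_derivative (\<lambda>y. g ((norm y)\<^sup>2) * solidV l 1 y) i (Re D) x"
    and "has_partial_derivative (\<lambda>y. g ((norm y)\<^sup>2) * solidV l (-1) y) i (Im D) x"
proof -
  define y where "y h = x + h *\<^sub>R axis i 1" for h :: real
  have z_y: "Complex (y h $ 1) (y h $ 2) = z + of_real h * d" for h
    using exhaust_2[of i] by (auto simp: y_def z_def d_def axis_def complex_eq_iff)
  have norm_y: "(norm (y h))\<^sup>2 = (norm x)\<^sup>2 + h * (2 * x $ i) + h\<^sup>2" for h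
    unfolding y_def power2_norm_eq_inner
    by (simp add: inner_add_left inner_add_right inner_axis inner_commute[of "axis i 1"]
        power2_eq_square algebra_simps)
  have "((\<lambda>h. (norm (y h))\<^sup>2) has_real_derivative 2 * x $ i) (at 0)"
    unfolding norm_y by (auto intro!: derivative_eq_intros)
  hence "((\<lambda>h. g ((norm (y h))\<^sup>2)) has_real_derivative g' * (2 * x $ i)) (at 0)"
    using DERIV_chain2[of g g' "\<lambda>h. (norm (y h))\<^sup>2" 0] g by (simp add: y_def)
  hence 1: "((\<lambda>h. complex_of_real (g ((norm (y h))\<^sup>2))) has_vector_derivative
      of_real (g' * (2 * x $ i))) (at 0)"
    by (intro has_vector_derivative_of_real) (simp add: has_real_derivative_iff_has_vector_derivative)
  \<comment> \<open>The power is differentiated in a complex variable \<open>w\<close> and then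
    restricted to the real line.\<close>
  have "((\<lambda>w. (z + w * d) ^ l) has_field_derivative of_nat l * z ^ (l - 1) * d) (at (of_real 0))"
    by (auto intro!: derivative_eq_intros)
  hence 2: "((\<lambda>h. (z + of_real h * d) ^ l) has_vector_derivative of_nat l * z ^ (l - 1) * d) (at (0::real))"
    by (rule has_vector_derivative_real_field)
  have 3: "((\<lambda>h. (z + of_real h * d) ^ l * of_real (g ((norm (y h))\<^sup>2))) has_vector_derivative D) (at 0)"
    using has_vector_derivative_mult[OF 2 1] by (simp add: D_def y_def algebra_simps)
  have V: "(z + of_real h * d) ^ l = Complex (solidV l 1 (y h)) (solidV l (-1) (y h))" for h
    by (simp only: solidV_Complex z_y)
  show "has_partial_derivative (\<lambda>y. g ((norm y)\<^sup>2) * solidV l 1 y) i (Re D) x"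
    using bounded_linear.has_vector_derivative[OF bounded_linear_Re 3]
    unfolding has_partial_derivative_def y_def[symmetric] V
    by (simp add: has_real_derivative_iff_has_vector_derivative mult.commute)
  show "has_partial_derivative (\<lambda>y. g ((norm y)\<^sup>2) * solidV l (-1) y) i (Im D) x"
    using bounded_linear.has_vector_derivative[OF bounded_linear_Im 3]
    unfolding has_partial_derivative_def y_def[symmetric] V
    by (simp add: has_real_derivative_iff_has_vector_derivative mult.commute)
qed

text \<open>Serves to replace \<open>f\<close>, prescribed only on the disk, by its formula:
  \<open>x + h *\<^sub>R axis i 1\<close> stays in \<open>S\<close> for small
  \<open>h\<close>.\<close>

lemma has_partial_derivative_cong_open:
  assumes "has_partial_derivative g i D x" "open S" "x \<in> S" "\<And>y. y \<in> S \<Longrightarrow> f y = g y"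
  shows "has_partial_derivative f i D x"
proof -
  have "open ((\<lambda>h. x + h *\<^sub>R axis i 1) -` S)"
    using \<open>open S\<close> by (intro continuous_open_vimage) (auto intro!: continuous_intros)
  thus ?thesis
    using assms unfolding has_partial_derivative_def
    by (elim has_field_derivative_transform_within_open) auto
qed

text \<open>\<open>G\<close> and \<open>A\<close> stand for g and g' at the squared norm. The part
  of \<open>2 * x $ i\<close> with \<open>cnj z\<close> lowers the power, since
  \<open>z * cnj z\<close> is that squared norm and \<open>l \<ge> 1\<close> leaves a
  \<open>z\<close> to pair with; the part with \<open>z\<close> raises it.\<close>

lemma radial_deriv_ladder:
  fixes x :: "real ^ 2" and G A B :: real and i :: 2
  defines "z \<equiv> Complex (x $ 1) (x $ 2)"
  defines "d \<equiv> (if i = 1 then 1 else \<i>)"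
  assumes l: "l \<ge> 1" and B: "real l * G + (norm x)\<^sup>2 * A = B"
  shows "of_nat l * z ^ (l - 1) * d * of_real G + z ^ l * of_real (A * (2 * x $ i)) =
         d * of_real B * z ^ (l - 1) + cnj d * of_real A * z ^ (l + 1)"
proof -
  obtain k where k: "l = Suc k" using l by (cases l) auto
  have xi: "of_real (2 * x $ i) = d * cnj z + cnj d * z"
    using exhaust_2[of i] by (auto simp: z_def d_def complex_eq_iff)
  have "z * cnj z = of_real ((norm x)\<^sup>2)"
    by (simp only: z_def norm_polar complex_norm_square)
  hence zz: "z ^ l * cnj z = z ^ (l - 1) * of_real ((norm x)\<^sup>2)"
    by (simp add: k mult_ac)
  have "of_nat l * z ^ (l - 1) * d * of_real G + z ^ l * of_real (A * (2 * x $ i)) =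
      of_nat l * z ^ (l - 1) * d * of_real G + of_real A * (d * (z ^ l * cnj z) + cnj d * (z * z ^ l))"
    unfolding of_real_mult[of A] xi by (simp add: algebra_simps)
  also have "\<dots> = d * (of_nat l * of_real G + of_real ((norm x)\<^sup>2) * of_real A) * z ^ (l - 1)
      + cnj d * of_real A * z ^ (l + 1)"
    unfolding zz by (simp add: algebra_simps)
  finally show ?thesis
    by (simp add: B[symmetric])
qed

theorem theorem3p1:
  fixes \<alpha> :: real and n l :: nat and \<mu> :: int and f :: "real ^ 2 \<Rightarrow> real"
  assumes "0 < \<alpha>" and "\<alpha> < 2" and "\<mu> \<in> {1, -1}"
    and f: "\<And>x. x \<in> ball 0 1 \<Longrightarrow>
          f x = (1 - (norm x)\<^sup>2) powr (\<alpha> / 2) * solidV l \<mu> x *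
                jacobiP n (\<alpha> / 2) (real l) (2 * (norm x)\<^sup>2 - 1)"
  shows "(l \<ge> 1 \<longrightarrow> (\<forall>x \<in> ball 0 1.
            has_partial_derivative f 1
              (- (real n + \<alpha> / 2) * (1 - (norm x)\<^sup>2) powr (\<alpha> / 2 - 1) * solidV (l + 1) \<mu> x *
                 jacobiP n (\<alpha> / 2 - 1) (real l + 1) (2 * (norm x)\<^sup>2 - 1)
               - (real n + 1) * (1 - (norm x)\<^sup>2) powr (\<alpha> / 2 - 1) * solidV (l - 1) \<mu> x *
                 jacobiP (n + 1) (\<alpha> / 2 - 1) (real l - 1) (2 * (norm x)\<^sup>2 - 1)) x \<and>
            has_partial_derivative f 2
              (- of_int \<mu> * (real n + \<alpha> / 2) * (1 - (norm x)\<^sup>2) powr (\<alpha> / 2 - 1) *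
                 solidV (l + 1) (- \<mu>) x *
                 jacobiP n (\<alpha> / 2 - 1) (real l + 1) (2 * (norm x)\<^sup>2 - 1)
               + of_int \<mu> * (real n + 1) * (1 - (norm x)\<^sup>2) powr (\<alpha> / 2 - 1) *
                 solidV (l - 1) (- \<mu>) x *
                 jacobiP (n + 1) (\<alpha> / 2 - 1) (real l - 1) (2 * (norm x)\<^sup>2 - 1)) x)) \<and>
         (l = 0 \<and> \<mu> = 1 \<longrightarrow> (\<forall>x \<in> ball 0 1.
            has_partial_derivative f 1
              (- 2 * (real n + \<alpha> / 2) * (1 - (norm x)\<^sup>2) powr (\<alpha> / 2 - 1) * solidV 1 1 x *
                 jacobiP n (\<alpha> / 2 - 1) 1 (2 * (norm x)\<^sup>2 - 1)) x \<and>
            has_partial_derivative f 2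
              (- 2 * (real n + \<alpha> / 2) * (1 - (norm x)\<^sup>2) powr (\<alpha> / 2 - 1) * solidV 1 (-1) x *
                 jacobiP n (\<alpha> / 2 - 1) 1 (2 * (norm x)\<^sup>2 - 1)) x))"
proof -
  define a where "a = \<alpha> / 2"
  define g where "g u = (1 - u) powr a * jacobiP n a (real l) (2 * u - 1)" for u
  define w where "w x = (1 - (norm x)\<^sup>2) powr (a - 1)" for x :: "real ^ 2"
  \<comment> \<open>\<open>A x\<close> will be the derivative of \<open>g\<close> at the squared
    norm, and \<open>B x\<close> the value given by \<open>weighted_jacobiP_euler\<close>.\<close>
  define A where "A x = - (real n + a) * (w x * jacobiP n (a - 1) (real l + 1) (2 * (norm x)\<^sup>2 - 1))"
    for x :: "real ^ 2"
  define B where "B x = - (real n + 1) * (w x * jacobiP (n + 1) (a - 1) (real l - 1) (2 * (norm x)\<^sup>2 - 1))"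
    for x :: "real ^ 2"
  define D where "D i x = of_nat l * Complex (x $ 1) (x $ 2) ^ (l - 1) * (if i = 1 then 1 else \<i>) *
      of_real (g ((norm x)\<^sup>2)) + Complex (x $ 1) (x $ 2) ^ l * of_real (A x * (2 * x $ i))"
    for i :: 2 and x :: "real ^ 2"
  have f': "has_partial_derivative f i (if \<mu> = 1 then Re (D i x) else Im (D i x)) x"
    if x: "x \<in> ball 0 1" for i x
  proof (rule has_partial_derivative_cong_open[OF _ open_ball x])
    have "(norm x)\<^sup>2 < 1"
      using x by (simp add: power_less_one_iff)
    hence "(g has_real_derivative A x) (at ((norm x)\<^sup>2))"
      unfolding g_def A_def w_def by (rule weighted_jacobiP_deriv)
    from solidV_radial_deriv[OF this, where i = i and l = l] \<open>\<mu> \<in> {1, -1}\<close>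
    show "has_partial_derivative (\<lambda>y. g ((norm y)\<^sup>2) * solidV l \<mu> y) i
        (if \<mu> = 1 then Re (D i x) else Im (D i x)) x"
      unfolding D_def by auto
  qed (simp add: f g_def a_def)
  have ladder: "D i x =
      (if i = 1 then 1 else \<i>) * of_real (B x) * Complex (solidV (l - 1) 1 x) (solidV (l - 1) (-1) x) +
      cnj (if i = 1 then 1 else \<i>) * of_real (A x) * Complex (solidV (l + 1) 1 x) (solidV (l + 1) (-1) x)"
    if x: "x \<in> ball 0 1" and l: "l \<ge> 1" for i x
    unfolding D_def solidV_Complex
  proof (rule radial_deriv_ladder[OF l])
    have "(norm x)\<^sup>2 < 1"
      using x by (simp add: power_less_one_iff)
    thus "real l * g ((norm x)\<^sup>2) + (norm x)\<^sup>2 * A x = B x"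
      unfolding g_def A_def B_def w_def by (rule weighted_jacobiP_euler)
  qed
  show ?thesis
  proof (intro conjI impI ballI)
    fix x :: "real ^ 2" assume l: "l \<ge> 1" and x: "x \<in> ball 0 1"
    show "has_partial_derivative f 1
              (- (real n + \<alpha> / 2) * (1 - (norm x)\<^sup>2) powr (\<alpha> / 2 - 1) * solidV (l + 1) \<mu> x *
                 jacobiP n (\<alpha> / 2 - 1) (real l + 1) (2 * (norm x)\<^sup>2 - 1)
               - (real n + 1) * (1 - (norm x)\<^sup>2) powr (\<alpha> / 2 - 1) * solidV (l - 1) \<mu> x *
                 jacobiP (n + 1) (\<alpha> / 2 - 1) (real l - 1) (2 * (norm x)\<^sup>2 - 1)) x"
      \<comment> \<open>Here the direction is 1, so each component of \<open>D 1 x\<close> involves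
        only harmonics with the same \<mu>. \<open>back_subst\<close> leaves an equality of
        derivative values.\<close>
      using f'[OF x, of 1] \<open>\<mu> \<in> {1, -1}\<close>
      by (auto simp: ladder[OF x l] A_def B_def w_def a_def algebra_simps
          elim!: back_subst[of "\<lambda>D. has_partial_derivative f _ D x"])
    show "has_partial_derivative f 2
              (- of_int \<mu> * (real n + \<alpha> / 2) * (1 - (norm x)\<^sup>2) powr (\<alpha> / 2 - 1) *
                 solidV (l + 1) (- \<mu>) x *
                 jacobiP n (\<alpha> / 2 - 1) (real l + 1) (2 * (norm x)\<^sup>2 - 1)
               + of_int \<mu> * (real n + 1) * (1 - (norm x)\<^sup>2) powr (\<alpha> / 2 - 1) *
                 solidV (l - 1) (- \<mu>) x *
                 jacobiP (n + 1) (\<alpha> / 2 - 1) (real l - 1) (2 * (norm x)\<^sup>2 - 1)) x"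
      \<comment> \<open>The direction \<i> and its conjugate swap real and imaginary parts with
        opposite signs, which turns \<mu> into \<open>- \<mu>\<close> and produces the factors
        \<open>of_int \<mu>\<close>.\<close>
      using f'[OF x, of 2] \<open>\<mu> \<in> {1, -1}\<close>
      by (auto simp: ladder[OF x l] A_def B_def w_def a_def algebra_simps
          elim!: back_subst[of "\<lambda>D. has_partial_derivative f _ D x"])
  next
    fix x :: "real ^ 2" assume l: "l = 0 \<and> \<mu> = 1" and x: "x \<in> ball 0 1"
    \<comment> \<open>For \<open>l = 0\<close> the term of \<open>D\<close> with
      \<open>of_nat l\<close> vanishes, leaving \<open>A x * (2 * x $ i)\<close>; the coordinates
      are the harmonics of degree 1, whence the factor 2.\<close>
    have V1: "solidV 1 1 x = x $ 1" "solidV 1 (-1) x = x $ 2"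
      using solidV_Complex[of 1 x] by simp_all
    show "has_partial_derivative f 1
              (- 2 * (real n + \<alpha> / 2) * (1 - (norm x)\<^sup>2) powr (\<alpha> / 2 - 1) * solidV 1 1 x *
                 jacobiP n (\<alpha> / 2 - 1) 1 (2 * (norm x)\<^sup>2 - 1)) x"
      using f'[OF x, of 1] l unfolding V1
      by (auto simp: D_def A_def w_def a_def algebra_simps
          elim!: back_subst[of "\<lambda>D. has_partial_derivative f _ D x"])
    show "has_partial_derivative f 2
              (- 2 * (real n + \<alpha> / 2) * (1 - (norm x)\<^sup>2) powr (\<alpha> / 2 - 1) * solidV 1 (-1) x *
                 jacobiP n (\<alpha> / 2 - 1) 1 (2 * (norm x)\<^sup>2 - 1)) x"
      using f'[OF x, of 2] l unfolding V1
      by (auto simp: D_def A_def w_def a_def algebra_simps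
          elim!: back_subst[of "\<lambda>D. has_partial_derivative f _ D x"])
  qed
qed

end
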